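(* Let $V$ be a finite dimensional real vector space, $B\subseteq V$ a compact convex polyhedral $0$-neighborhood with associated asymmetric polyhedral norm $\nu$, and equip $\bigsqcup\{V_{L}\mid L\in\Sigma\cup\{K\}\}$ with the topology imposed by the bijection $\Phi$ from the bordification $\widehat V$. Then for every $L\in\Sigma\cup\{K\}$, the closure of $V_L$ in $\bigsqcup\{V_{L'}\mid L'\in\Sigma\cup\{K\}\}$ is $$\bigsqcup\{V_{L'}\mid L'\in\Sigma\cup\{K\}\text{ with }L\supseteq L'\}.$$
   Context: $V$ is a finite dimensional real vector space with dual $V^\vee$, endowed with a Euclidean norm $\|\cdot\|$, and $0$ is the base point. $B\subseteq V$ is a compact convex polyhedral neighborhood of $0$ with codimension-1 faces $A_0,\dots,A_m$, and $K=\{0,\dots,m\}$. For each $j\in K$, $\xi_j\in V^\vee$ is the unique linear functional with $A_j=\{v\in B\mid \xi_j(v)=1\}$; thus $B=\{u\in V\mid \xi_j(u)\le 1\text{ for all }j\in K\}$, and the asymmetric norm with unit ball $B$ is $\nu(u)=\max\{\xi_0(u),\dots,\xi_m(u)\}$. Put $\delta(u,v)=\nu(u-v)$. A nonempty subset $L\subseteq K$ is a dual face if there is $v\in V$ with $\nu(v)=1$ and $L=\{k\in K\mid \xi_k(v)=1\}$; $\Sigma$ is the set of all dual faces. For nonempty $L\subseteq K$: $\nu_L(u)=\max\{\xi_\ell(u)\mid \ell\in L\}$ and $H_L=\{u\in V\mid \xi_k(u)=\xi_\ell(u)\text{ for all }k,\ell\in L\}$. Put $V_K=V$ and $V_L=V/H_L$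 for $L\in\Sigma$. The bordification $\widehat V$ is the closure of $\{u\mapsto\delta(p,u)-\delta(p,0)\mid p\in V\}$ in the space of continuous functions $f:V\to\mathbb R$ with $f(0)=0$, in the topology of uniform convergence on bounded sets. Its elements (normalized horofunctions) are exactly the functions $v\mapsto\nu(p-v)-\nu(p)$ with $p\in V$ and $v\mapsto\nu_L(p-v)-\nu_L(p)$ with $p\in V$, $L\in\Sigma$. The map $\Phi:\widehat V\to\bigsqcup\{V_L\mid L\in\Sigma\cup\{K\}\}$ sending the former to $p\in V_K$ and the latter to $p+H_L\in V_L$ is a bijection; the topology imposed by $\Phi$ is the one making $\Phi$ a homeomorphism. *)

theory Defs
  imports "HOL-Analysis.Analysis"
begin

text \<open>
  A family of functionals \<open>\<xi>\<close> is indexed by a finite set \<open>K\<close>. With \<open>L = K\<close> the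
  following is the asymmetric norm \<open>\<nu>\<close>.
\<close>

definition max_fun :: "('i \<Rightarrow> 'a \<Rightarrow> real) \<Rightarrow> 'i set \<Rightarrow> 'a \<Rightarrow> real"
  where "max_fun \<xi> L u = Max ((\<lambda>l. \<xi> l u) ` L)"

definition asym_dist :: "('i \<Rightarrow> 'a \<Rightarrow> real) \<Rightarrow> 'i set \<Rightarrow> 'a::euclidean_space \<Rightarrow> 'a \<Rightarrow> real"
  where "asym_dist \<xi> K u v = max_fun \<xi> K (u - v)"

definition dual_faces :: "('i \<Rightarrow> 'a \<Rightarrow> real) \<Rightarrow> 'i set \<Rightarrow> 'i set set"
  where "dual_faces \<xi> K =
    {L. L \<noteq> {} \<and> L \<subseteq> K \<and> (\<exists>v. max_fun \<xi> K v = 1 \<and> L = {k \<in> K. \<xi> k v = 1})}"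

definition equal_subspace :: "('i \<Rightarrow> 'a \<Rightarrow> real) \<Rightarrow> 'i set \<Rightarrow> 'a set"
  where "equal_subspace \<xi> L = {u. \<forall>k\<in>L. \<forall>l\<in>L. \<xi> k u = \<xi> l u}"

text \<open>
  The space \<open>V\<^sub>L\<close>. For \<open>L \<in> \<Sigma>\<close> it is the set of cosets of \<open>H\<^sub>L\<close>; \<open>V\<^sub>K\<close> is \<open>V\<close> itself, a
  point \<open>p\<close> being encoded as the singleton \<open>{p}\<close> so that all the \<open>V\<^sub>L\<close> consist of elements of
  one type.
\<close>

definition stratum :: "('i \<Rightarrow> 'a \<Rightarrow> real) \<Rightarrow> 'i set \<Rightarrow> 'i set \<Rightarrow> 'a::euclidean_space set set"
  where "stratum \<xi> K L =
    (if L = K then range (\<lambda>p. {p}) else UNIV // {(u, v). u - v \<in> equal_subspace \<xi> L})"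

definition strata :: "('i \<Rightarrow> 'a \<Rightarrow> real) \<Rightarrow> 'i set \<Rightarrow> ('i set \<times> 'a::euclidean_space set) set"
  where "strata \<xi> K = (SIGMA L : dual_faces \<xi> K \<union> {K}. stratum \<xi> K L)"

definition pointed_continuous :: "('a::euclidean_space \<Rightarrow> real) set"
  where "pointed_continuous = {f. continuous_on UNIV f \<and> f 0 = 0}"

text \<open>The topology of uniform convergence on bounded sets.\<close>

definition ucb_topology :: "('a::euclidean_space \<Rightarrow> real) topology"
  where "ucb_topology = topology (\<lambda>U. U \<subseteq> pointed_continuous \<and>
    (\<forall>f\<in>U. \<exists>S \<epsilon>. bounded S \<and> \<epsilon> > 0 \<and>
      {g \<in> pointed_continuous. \<forall>x\<in>S. \<bar>g x - f x\<bar> < \<epsilon>} \<subseteq> U))"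

lemma openin_ucb_topology:
  fixes U :: "('a::euclidean_space \<Rightarrow> real) set"
  shows "openin ucb_topology U \<longleftrightarrow> U \<subseteq> pointed_continuous \<and>
    (\<forall>f\<in>U. \<exists>S \<epsilon>. bounded S \<and> \<epsilon> > 0 \<and>
      {g \<in> pointed_continuous. \<forall>x\<in>S. \<bar>g x - f x\<bar> < \<epsilon>} \<subseteq> U)"
proof -
  have "istopology (\<lambda>U :: ('a \<Rightarrow> real) set. U \<subseteq> pointed_continuous \<and>
    (\<forall>f\<in>U. \<exists>S \<epsilon>. bounded S \<and> \<epsilon> > 0 \<and>
      {g \<in> pointed_continuous. \<forall>x\<in>S. \<bar>g x - f x\<bar> < \<epsilon>} \<subseteq> U))" (is "istopology ?P")
    unfolding istopology_def
  proof (intro conjI allI impI)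
    fix U W :: "('a \<Rightarrow> real) set"
    assume U: "?P U" and W: "?P W"
    show "U \<inter> W \<subseteq> pointed_continuous" using U by blast
    show "\<forall>f\<in>U \<inter> W. \<exists>S \<epsilon>. bounded S \<and> \<epsilon> > 0 \<and>
      {g \<in> pointed_continuous. \<forall>x\<in>S. \<bar>g x - f x\<bar> < \<epsilon>} \<subseteq> U \<inter> W"
    proof
      fix f assume f: "f \<in> U \<inter> W"
      obtain S d where 1: "bounded S" "d > 0"
        "{g \<in> pointed_continuous. \<forall>x\<in>S. \<bar>g x - f x\<bar> < d} \<subseteq> U"
        using U f by (meson IntD1)
      obtain T e where 2: "bounded T" "e > 0"
        "{g \<in> pointed_continuous. \<forall>x\<in>T. \<bar>g x - f x\<bar> < e} \<subseteq> W"
        using W f by (meson IntD2)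
      have "bounded (S \<union> T) \<and> min d e > 0 \<and>
        {g \<in> pointed_continuous. \<forall>x\<in>S \<union> T. \<bar>g x - f x\<bar> < min d e} \<subseteq> U \<inter> W"
      proof (intro conjI)
        show "bounded (S \<union> T)" "min d e > 0" using 1 2 by simp_all
        show "{g \<in> pointed_continuous. \<forall>x\<in>S \<union> T. \<bar>g x - f x\<bar> < min d e} \<subseteq> U \<inter> W"
        proof
          fix g assume "g \<in> {g \<in> pointed_continuous. \<forall>x\<in>S \<union> T. \<bar>g x - f x\<bar> < min d e}"
          then have "g \<in> {g \<in> pointed_continuous. \<forall>x\<in>S. \<bar>g x - f x\<bar> < d}"
            and "g \<in> {g \<in> pointed_continuous. \<forall>x\<in>T. \<bar>g x - f x\<bar> < e}" by simp_all
          then show "g \<in> U \<inter> W" using 1(3) 2(3) by (meson IntI subsetD)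
        qed
      qed
      then show "\<exists>S \<epsilon>. bounded S \<and> \<epsilon> > 0 \<and>
        {g \<in> pointed_continuous. \<forall>x\<in>S. \<bar>g x - f x\<bar> < \<epsilon>} \<subseteq> U \<inter> W"
        by (intro exI)
    qed
  next
    fix \<U> :: "('a \<Rightarrow> real) set set"
    assume U: "\<forall>W\<in>\<U>. ?P W"
    show "\<Union>\<U> \<subseteq> pointed_continuous" using U by blast
    show "\<forall>f\<in>\<Union>\<U>. \<exists>S \<epsilon>. bounded S \<and> \<epsilon> > 0 \<and>
      {g \<in> pointed_continuous. \<forall>x\<in>S. \<bar>g x - f x\<bar> < \<epsilon>} \<subseteq> \<Union>\<U>"
    proof
      fix f assume "f \<in> \<Union>\<U>"
      then obtain W where W: "W \<in> \<U>" "f \<in> W" by blast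
      then obtain S d where "bounded S" "d > 0"
        "{g \<in> pointed_continuous. \<forall>x\<in>S. \<bar>g x - f x\<bar> < d} \<subseteq> W"
        using U by meson
      moreover have "W \<subseteq> \<Union>\<U>" using W(1) by (rule Union_upper)
      ultimately show "\<exists>S \<epsilon>. bounded S \<and> \<epsilon> > 0 \<and>
        {g \<in> pointed_continuous. \<forall>x\<in>S. \<bar>g x - f x\<bar> < \<epsilon>} \<subseteq> \<Union>\<U>"
        by (meson subset_trans)
    qed
  qed
  then show ?thesis
    by (simp add: ucb_topology_def topology_inverse')
qed

lemma topspace_ucb_topology:
  "topspace ucb_topology = (pointed_continuous :: ('a::euclidean_space \<Rightarrow> real) set)"
proof -
  have "\<exists>S \<epsilon>. bounded S \<and> \<epsilon> > 0 \<and>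
      {g \<in> pointed_continuous. \<forall>x\<in>S. \<bar>g x - f x\<bar> < \<epsilon>} \<subseteq> pointed_continuous"
    for f :: "'a \<Rightarrow> real"
    using bounded_empty zero_less_one by blast
  then have "openin ucb_topology (pointed_continuous :: ('a \<Rightarrow> real) set)"
    unfolding openin_ucb_topology by blast
  moreover have "topspace ucb_topology \<subseteq> (pointed_continuous :: ('a \<Rightarrow> real) set)"
    using openin_topspace[of ucb_topology] unfolding openin_ucb_topology by (rule conjunct1)
  ultimately show ?thesis
    using openin_subset by blast
qed

definition bordification :: "('i \<Rightarrow> 'a \<Rightarrow> real) \<Rightarrow> 'i set \<Rightarrow> ('a::euclidean_space \<Rightarrow> real) set"
  where "bordification \<xi> K =
    ucb_topology closure_of range (\<lambda>p u. asym_dist \<xi> K p u - asym_dist \<xi> K p 0)"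

definition horofunction :: "('i \<Rightarrow> 'a \<Rightarrow> real) \<Rightarrow> 'i set \<Rightarrow> 'a::euclidean_space \<Rightarrow> 'a \<Rightarrow> real"
  where "horofunction \<xi> L p v = max_fun \<xi> L (p - v) - max_fun \<xi> L p"

text \<open>
  The bijection \<open>\<Phi>\<close>. The description operator is justified by the fact that every element of
  the bordification is of exactly one of the two forms, with \<open>L\<close> unique and \<open>p\<close> unique,
  respectively unique modulo \<open>H\<^sub>L\<close>.
\<close>

definition Phi :: "('i \<Rightarrow> 'a \<Rightarrow> real) \<Rightarrow> 'i set \<Rightarrow> ('a::euclidean_space \<Rightarrow> real) \<Rightarrow> 'i set \<times> 'a set"
  where "Phi \<xi> K f = (THE x.
    (\<exists>p. f = horofunction \<xi> K p \<and> x = (K, {p})) \<or>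
    (\<exists>L\<in>dual_faces \<xi> K. \<exists>p. f = horofunction \<xi> L p \<and> x = (L, (+) p ` equal_subspace \<xi> L)))"

text \<open>
  The topology imposed by \<open>\<Phi>\<close>: pulling back along the inverse of the bijection \<open>\<Phi>\<close> makes
  \<open>\<Phi>\<close> a homeomorphism.
\<close>

definition strata_topology :: "('i \<Rightarrow> 'a \<Rightarrow> real) \<Rightarrow> 'i set \<Rightarrow> ('i set \<times> 'a::euclidean_space set) topology"
  where "strata_topology \<xi> K =
    pullback_topology (strata \<xi> K) (inv_into (bordification \<xi> K) (Phi \<xi> K))
      (subtopology ucb_topology (bordification \<xi> K))"

end

theory Submission
  imports Defs
begin

text \<open>
  Since \<open>B\<close> is bounded, \<open>H\<^sub>K = 0\<close>, so \<open>V\<^sub>K\<close> is a coset space like the others, and all strata can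
  be treated alike. Write \<open>h L p v = \<nu>\<^sub>L(p - v) - \<nu>\<^sub>L(p)\<close>. It suffices to show that the closure
  of \<open>{h L p | p \<in> V}\<close> consists of the \<open>h L' p\<close> with \<open>L' \<subseteq> L\<close>, and that \<open>h L p\<close> determines \<open>L\<close>
  and \<open>p + H\<^sub>L\<close>; the case \<open>L = K\<close> describes the bordification itself.
  If \<open>v\<close> is a direction in which the functionals in \<open>L'\<close> agree and exceed all others, then
  \<open>h L (p + t v)\<close> equals \<open>h L' p\<close> on any given bounded set once \<open>t\<close> is large. Conversely, if
  \<open>h L (p n)\<close> converges, pass to a subsequence such that each \<open>\<xi> l (p n) - \<nu>\<^sub>L(p n)\<close> with
  \<open>l \<in> L\<close> is bounded or tends to \<open>-\<infinity>\<close>, and let \<open>L'\<close> collect the bounded ones. Then the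
  component of \<open>p n\<close> orthogonal to \<open>H\<close>, the subspace belonging to \<open>L'\<close>, stays bounded and so
  accumulates at some \<open>p\<close>; the limit is \<open>h L' p\<close>, and the component in \<open>H\<close> shows that \<open>L'\<close> is
  a dual face.
\<close>

section \<open>Maxima of finitely many functionals\<close>

lemma max_fun_lessI:
  assumes "finite L" "L \<noteq> {}" "\<And>l. l \<in> L \<Longrightarrow> \<xi> l u < c"
  shows "max_fun \<xi> L u < c"
  using assms by (simp add: max_fun_def)

lemma le_max_fun:
  assumes "finite L" "l \<in> L"
  shows "\<xi> l u \<le> max_fun \<xi> L u"
  using assms by (simp add: max_fun_def)

lemma max_fun_attained:
  assumes "finite L" "L \<noteq> {}"
  obtains l where "l \<in> L" "max_fun \<xi> L u = \<xi> l u"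
proof -
  have "max_fun \<xi> L u \<in> (\<lambda>l. \<xi> l u) ` L"
    unfolding max_fun_def using assms by (intro Max_in) auto
  then show thesis using that by blast
qed

lemma max_fun_eqI:
  assumes "finite L" "l \<in> L" "\<xi> l u = c" "\<And>k. k \<in> L \<Longrightarrow> \<xi> k u \<le> c"
  shows "max_fun \<xi> L u = c"
  unfolding max_fun_def
proof (rule Max_eqI)
  show "c \<in> (\<lambda>l. \<xi> l u) ` L" using assms(2,3) by (metis imageI)
qed (use assms(1,4) in auto)

text \<open>Any single \<open>l \<in> L'\<close> stays below the maximum over \<open>L'\<close>, so
  it is enough that one such \<open>l\<close> beats the discarded indices; the closure arguments fix
  one \<open>l\<close> for this purpose.\<close>

lemma max_fun_restrict:
  assumes "finite L" "L' \<subseteq> L" "l \<in> L'" "\<And>k. k \<in> L - L' \<Longrightarrow> \<xi> k u \<le> \<xi> l u"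
  shows "max_fun \<xi> L u = max_fun \<xi> L' u"
proof -
  have fin: "finite L'" using assms finite_subset by blast
  obtain j where j: "j \<in> L'" "max_fun \<xi> L' u = \<xi> j u"
    by (rule max_fun_attained[OF fin, where \<xi> = \<xi> and u = u]) (use assms(3) in auto)
  have *: "\<xi> k u \<le> \<xi> j u" if "k \<in> L'" for k
    using le_max_fun[OF fin that, of \<xi> u] j by simp
  show ?thesis
    unfolding j(2)
  proof (rule max_fun_eqI[of L j])
    fix k assume "k \<in> L"
    then show "\<xi> k u \<le> \<xi> j u"
      using *[of k] *[OF assms(3)] assms(4)[of k] by (cases "k \<in> L'") auto
  qed (use assms j in auto)
qed

lemma max_fun_shift:
  assumes "finite L" "L \<noteq> {}" "\<And>l. l \<in> L \<Longrightarrow> \<xi> l v = \<xi> l u + c"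
  shows "max_fun \<xi> L v = max_fun \<xi> L u + c"
proof -
  obtain j where j: "j \<in> L" "max_fun \<xi> L u = \<xi> j u"
    using max_fun_attained[OF assms(1,2), where \<xi> = \<xi> and u = u] .
  show ?thesis
  proof (rule max_fun_eqI[OF assms(1) j(1)])
    show "\<xi> j v = max_fun \<xi> L u + c" using assms(3) j by simp
    show "\<xi> k v \<le> max_fun \<xi> L u + c" if "k \<in> L" for k
      using assms(3)[OF that] le_max_fun[OF assms(1) that, of \<xi> u] by simp
  qed
qed

lemma continuous_on_max_fun:
  assumes "finite L" "L \<noteq> {}" "\<And>l. l \<in> L \<Longrightarrow> continuous_on S (\<xi> l)"
  shows "continuous_on S (max_fun \<xi> L)"
  using assms
proof (induction L rule: finite_ne_induct)
  case (singleton l)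
  then show ?case by (simp add: max_fun_def[abs_def])
next
  case (insert l F)
  have "max_fun \<xi> (insert l F) = (\<lambda>u. max (\<xi> l u) (max_fun \<xi> F u))"
    using insert by (intro ext) (simp add: max_fun_def)
  then show ?case using insert by (simp add: continuous_on_max)
qed

text \<open>The larger slope wins for large \<open>t\<close>, and finiteness of \<open>F\<close>
  gives a common threshold. The intercepts are arbitrary, so that error terms can be absorbed in
  them.\<close>

lemma eventually_affine_less:
  fixes a x :: "'i \<Rightarrow> real"
  assumes "finite F" "\<And>k. k \<in> F \<Longrightarrow> x k < y"
  shows "\<forall>\<^sub>F t in at_top. \<forall>k\<in>F. a k + t * x k < b + t * y"
proof (rule eventually_ball_finite[OF assms(1)], rule)
  fix k assume "k \<in> F"
  then have "y - x k > 0" using assms by simp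
  then have "\<forall>\<^sub>F t in at_top. (a k - b) / (y - x k) < t"
    by (rule_tac eventually_gt_at_top)
  then show "\<forall>\<^sub>F t in at_top. a k + t * x k < b + t * y"
    by eventually_elim (use \<open>y - x k > 0\<close> in \<open>simp add: field_simps\<close>)
qed

section \<open>Closures in pullback topologies and under uniform convergence on bounded sets\<close>

text \<open>The open sets of the pullback are the traces on \<open>A\<close> of preimages, so
  testing neighborhoods of \<open>x\<close> against \<open>S\<close> amounts to testing those of
  \<open>f x\<close> against the image of \<open>S\<close>.\<close>

lemma closure_of_pullback_topology:
  assumes "f ` A \<subseteq> topspace T" "S \<subseteq> A"
  shows "pullback_topology A f T closure_of S = {x \<in> A. f x \<in> T closure_of (f ` S)}"
proof -
  have "x \<in> pullback_topology A f T closure_of S \<longleftrightarrow> x \<in> A \<and> f x \<in> T closure_of (f ` S)" for x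
  proof -
    have *: "(\<forall>W. x \<in> W \<and> (\<exists>U. openin T U \<and> W = f -` U \<inter> A) \<longrightarrow> (\<exists>y. y \<in> S \<and> y \<in> W)) \<longleftrightarrow>
      (\<forall>U. f x \<in> U \<and> openin T U \<longrightarrow> (\<exists>y\<in>S. f y \<in> U))" (is "?l \<longleftrightarrow> ?r") if "x \<in> A"
    proof
      assume l: ?l
      show ?r
      proof (intro allI impI)
        fix U assume "f x \<in> U \<and> openin T U"
        then show "\<exists>y\<in>S. f y \<in> U"
          using l[rule_format, of "f -` U \<inter> A"] that by blast
      qed
    next
      assume ?r
      then show ?l using assms(2) by (metis IntD1 IntI subsetD vimageD vimageI)
    qed
    show ?thesis
    proof (cases "x \<in> A")
      case True
      then have "f x \<in> topspace T" using assms(1) by blast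
      with True show ?thesis
        unfolding in_closure_of topspace_pullback_topology openin_pullback_topology *[OF True]
        by auto
    qed (simp add: in_closure_of topspace_pullback_topology)
  qed
  then show ?thesis by blast
qed

lemma in_closure_of_ucb_topology:
  assumes "A \<subseteq> pointed_continuous"
  shows "f \<in> ucb_topology closure_of A \<longleftrightarrow> f \<in> pointed_continuous \<and>
    (\<forall>S e. bounded S \<longrightarrow> e > 0 \<longrightarrow> (\<exists>g\<in>A. \<forall>x\<in>S. \<bar>g x - f x\<bar> < e))" (is "?l \<longleftrightarrow> ?r")
proof
  assume l: ?l
  then have f: "f \<in> pointed_continuous"
    by (simp add: in_closure_of topspace_ucb_topology)
  have "\<exists>g\<in>A. \<forall>x\<in>S. \<bar>g x - f x\<bar> < e" if S: "bounded S" and e: "e > 0" for S e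
  proof -
    \<comment> \<open>The pointwise condition with \<open>< e\<close> need not be open when
      \<open>S\<close> is infinite, since the supremum may reach \<open>e\<close>. A uniform bound
      \<open>d < e\<close> leaves the margin \<open>(e - d) / 2\<close> for perturbations.\<close>
    let ?U = "{g \<in> pointed_continuous. \<exists>d<e. \<forall>x\<in>S. \<bar>g x - f x\<bar> \<le> d}"
    have "openin ucb_topology ?U"
      unfolding openin_ucb_topology
    proof (intro conjI ballI)
      fix g assume "g \<in> ?U"
      then obtain d where d: "d < e" "\<forall>x\<in>S. \<bar>g x - f x\<bar> \<le> d" by blast
      have "{h \<in> pointed_continuous. \<forall>x\<in>S. \<bar>h x - g x\<bar> < (e - d) / 2} \<subseteq> ?U"
      proof safe
        fix h assume h: "\<forall>x\<in>S. \<bar>h x - g x\<bar> < (e - d) / 2"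
        show "\<exists>d<e. \<forall>x\<in>S. \<bar>h x - f x\<bar> \<le> d"
        proof (intro exI conjI ballI)
          show "d + (e - d) / 2 < e" using d by (simp add: field_simps)
          fix x assume "x \<in> S"
          then show "\<bar>h x - f x\<bar> \<le> d + (e - d) / 2"
            using d(2) h by (smt (verit))
        qed
      qed
      moreover have "(e - d) / 2 > 0" using d by simp
      ultimately show "\<exists>S \<epsilon>. bounded S \<and> \<epsilon> > 0 \<and>
        {h \<in> pointed_continuous. \<forall>x\<in>S. \<bar>h x - g x\<bar> < \<epsilon>} \<subseteq> ?U"
        using S by blast
    qed auto
    moreover have "f \<in> ?U"
    proof -
      have "\<exists>d<e. \<forall>x\<in>S. \<bar>f x - f x\<bar> \<le> d" using e by (intro exI[of _ 0]) simp
      then show ?thesis using f by simp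
    qed
    moreover have "\<forall>T. f \<in> T \<and> openin ucb_topology T \<longrightarrow> (\<exists>y. y \<in> A \<and> y \<in> T)"
      using l unfolding in_closure_of by (rule conjunct2)
    ultimately have "\<exists>y. y \<in> A \<and> y \<in> ?U" by (simp only: simp_thms)
    then obtain g d where "g \<in> A" "d < e" "\<forall>x\<in>S. \<bar>g x - f x\<bar> \<le> d" by blast
    then show ?thesis by (meson le_less_trans)
  qed
  then show ?r using f by blast
next
  assume r: ?r
  show ?l
    unfolding in_closure_of topspace_ucb_topology
  proof (intro conjI allI impI)
    show "f \<in> pointed_continuous" using r by blast
    fix T assume "f \<in> T \<and> openin ucb_topology T"
    then obtain S e where "bounded S" "e > 0"
      "{g \<in> pointed_continuous. \<forall>x\<in>S. \<bar>g x - f x\<bar> < e} \<subseteq> T"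
      unfolding openin_ucb_topology by blast
    moreover then obtain g where "g \<in> A" "\<forall>x\<in>S. \<bar>g x - f x\<bar> < e" using r by blast
    ultimately show "\<exists>y. y \<in> A \<and> y \<in> T" using assms by blast
  qed
qed

section \<open>Compactness: subsequences and the orthogonal complement of
  \<open>equal_subspace\<close>\<close>

text \<open>Induction on \<open>L\<close>: for each new index, compactness of the extended reals
  refines the subsequence so that its values converge. The upper bound 0 excludes the limit
  \<open>\<infinity>\<close>, and both alternatives survive further refinement.\<close>

lemma subsequence_bounded_or_at_bot:
  fixes c :: "'i \<Rightarrow> nat \<Rightarrow> real"
  assumes "finite L" "\<forall>l\<in>L. \<forall>n. c l n \<le> 0"
  shows "\<exists>r L'. strict_mono (r :: nat \<Rightarrow> nat) \<and> L' \<subseteq> L \<and> (\<forall>l\<in>L'. \<exists>b. \<forall>n. b \<le> c l (r n)) \<and>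
    (\<forall>l\<in>L - L'. filterlim (\<lambda>n. c l (r n)) at_bot sequentially)"
  using assms
proof (induction L)
  case empty
  then show ?case by (auto intro!: exI[of _ id] strict_mono_id)
next
  case (insert x F)
  then have "\<forall>l\<in>F. \<forall>n. c l n \<le> 0" by blast
  from insert.IH[OF this]
  obtain r L' where r: "strict_mono (r :: nat \<Rightarrow> nat)" "L' \<subseteq> F"
    "\<forall>l\<in>L'. \<exists>b. \<forall>n. b \<le> c l (r n)"
    "\<forall>l\<in>F - L'. filterlim (\<lambda>n. c l (r n)) at_bot sequentially"
    by blast
  obtain y q where q: "strict_mono (q :: nat \<Rightarrow> nat)"
    "((\<lambda>n. ereal (c x (r n))) \<circ> q) \<longlonglongrightarrow> y"
    using compact_complete_linorder by blast
  define s where "s n = r (q n)" for n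
  have rq: "strict_mono s" using r(1) q(1) by (simp add: s_def strict_mono_def)
  have L': "\<forall>l\<in>L'. \<exists>b. \<forall>n. b \<le> c l (s n)" using r(3) unfolding s_def by blast
  have F: "\<forall>l\<in>F - L'. filterlim (\<lambda>n. c l (s n)) at_bot sequentially"
  proof
    fix l assume "l \<in> F - L'"
    then have "filterlim (\<lambda>n. c l (r n)) at_bot sequentially" using r by blast
    then show "filterlim (\<lambda>n. c l (s n)) at_bot sequentially"
      unfolding s_def by (rule filterlim_compose[OF _ filterlim_subseq[OF q(1)]])
  qed
  show ?case
  proof (cases "y = -\<infinity>")
    case True
    then have "filterlim (\<lambda>n. c x (s n)) at_bot sequentially"
      using q(2) unfolding filterlim_at_bot_dense
      by (simp add: o_def tendsto_MInfty s_def)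
    with rq L' F r(2) show ?thesis
      by (intro exI[of _ s] exI[of _ L'] conjI) auto
  next
    case False
    have "y \<le> 0"
      by (rule LIMSEQ_le_const2[OF q(2)]) (simp add: insert.prems)
    with False obtain z where "y = ereal z" by (cases y) auto
    then have "(\<lambda>n. c x (s n)) \<longlonglongrightarrow> z" using q(2) by (simp add: o_def s_def)
    then have "Bseq (\<lambda>n. c x (s n))" using convergentI convergent_imp_Bseq by blast
    then obtain B where "\<forall>n. \<bar>c x (s n)\<bar> \<le> B" unfolding Bseq_def by auto
    then have "\<forall>n. -B \<le> c x (s n)" by (meson abs_le_D2 minus_le_iff)
    with rq L' F r(2) show ?thesis
      by (intro exI[of _ s] exI[of _ "insert x L'"] conjI) auto
  qed
qed

lemma subspace_equal_subspace:
  assumes "\<And>l. l \<in> L \<Longrightarrow> linear (\<xi> l)"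
  shows "subspace (equal_subspace \<xi> L)"
proof (rule subspaceI)
  show "0 \<in> equal_subspace \<xi> L"
    using assms by (simp add: equal_subspace_def linear_0)
next
  fix u v assume uv: "u \<in> equal_subspace \<xi> L" "v \<in> equal_subspace \<xi> L"
  have "\<xi> k (u + v) = \<xi> l (u + v)" if kl: "k \<in> L" "l \<in> L" for k l
  proof -
    have "\<xi> k u = \<xi> l u" "\<xi> k v = \<xi> l v"
      using uv kl unfolding equal_subspace_def by blast+
    then show ?thesis by (simp add: assms kl linear_add)
  qed
  then show "u + v \<in> equal_subspace \<xi> L"
    unfolding equal_subspace_def by blast
next
  fix c u assume u: "u \<in> equal_subspace \<xi> L"
  have "\<xi> k (c *\<^sub>R u) = \<xi> l (c *\<^sub>R u)" if kl: "k \<in> L" "l \<in> L" for k l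
  proof -
    have "\<xi> k u = \<xi> l u"
      using u kl unfolding equal_subspace_def by blast
    then show ?thesis by (simp add: assms kl linear_scale)
  qed
  then show "c *\<^sub>R u \<in> equal_subspace \<xi> L"
    unfolding equal_subspace_def by blast
qed

text \<open>The sum on the right is a seminorm in \<open>b\<close> that vanishes only on
  \<open>equal_subspace \<xi> L\<close>. On the unit sphere of the orthogonal complement it is
  therefore positive, and by compactness bounded below; homogeneity does the rest.\<close>

lemma orthogonal_equal_subspace_bound:
  fixes \<xi> :: "'i \<Rightarrow> 'a::euclidean_space \<Rightarrow> real"
  assumes fin: "finite L" and l: "l \<in> L" and lin: "\<And>k. k \<in> L \<Longrightarrow> linear (\<xi> k)"
  obtains e where "e > 0"
    "\<And>b. b \<in> (equal_subspace \<xi> L)\<^sup>\<bottom> \<Longrightarrow> e * norm b \<le> (\<Sum>k\<in>L. \<bar>\<xi> k b - \<xi> l b\<bar>)"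
proof -
  define N where "N b = (\<Sum>k\<in>L. \<bar>\<xi> k b - \<xi> l b\<bar>)" for b
  define H where "H = equal_subspace \<xi> L"
  define S where "S = sphere 0 1 \<inter> H\<^sup>\<bottom>"
  have "compact S"
    unfolding S_def by (intro compact_Int_closed closed_subspace subspace_orthogonal_comp) simp
  have scale: "N (c *\<^sub>R b) = \<bar>c\<bar> * N b" for c b
    unfolding N_def sum_distrib_left
    by (intro sum.cong) (simp_all add: lin l linear_scale abs_mult flip: right_diff_distrib)
  have pos: "N b > 0" if "b \<in> S" for b
  proof (rule ccontr)
    assume "\<not> N b > 0"
    moreover have "N b \<ge> 0" unfolding N_def by (intro sum_nonneg) simp
    ultimately have "N b = 0" by simp
    then have "\<forall>k\<in>L. \<xi> k b = \<xi> l b"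
      unfolding N_def using fin by (subst (asm) sum_nonneg_eq_0_iff) auto
    then have "b \<in> H" unfolding H_def equal_subspace_def by simp
    then have "b = 0"
      using that by (auto simp: S_def orthogonal_comp_def orthogonal_def)
    then show False using that by (simp add: S_def)
  qed
  have cont: "continuous_on S N"
    unfolding N_def
    by (intro continuous_intros linear_continuous_on linear_conv_bounded_linear[THEN iffD1] lin l)
  obtain e where e: "e > 0" "\<And>b. b \<in> S \<Longrightarrow> e \<le> N b"
  proof (cases "S = {}")
    \<comment> \<open>Without unit vectors the complement is zero, and any positive \<open>e\<close>
      serves.\<close>
    case True
    then show ?thesis using that[of 1] by simp
  next
    case False
    then obtain x where "x \<in> S" "\<forall>y\<in>S. N x \<le> N y"
      using continuous_attains_inf[OF \<open>compact S\<close> _ cont] by blast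
    then show ?thesis using that pos by blast
  qed
  have "e * norm b \<le> N b" if "b \<in> H\<^sup>\<bottom>" for b
  proof (cases "b = 0")
    case True
    then show ?thesis using scale[of 0 b] by simp
  next
    case False
    then have "b /\<^sub>R norm b \<in> S"
      using that by (simp add: S_def subspace_scale subspace_orthogonal_comp)
    then have "e \<le> N (b /\<^sub>R norm b)" by (rule e)
    then show ?thesis unfolding scale using False by (simp add: field_simps)
  qed
  then show thesis using that e(1) unfolding N_def H_def by blast
qed

section \<open>The polyhedral norm and the index set of the strata\<close>

text \<open>What the argument uses of \<open>B\<close>: \<open>ex_pos\<close> expresses that the
  unit ball is bounded, and \<open>irredundant\<close> that each functional attains the maximum
  alone at some point of its facet.\<close>

locale polyhedral_norm =
  fixes \<xi> :: "'i \<Rightarrow> 'a::euclidean_space \<Rightarrow> real" and K :: "'i set"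
  assumes finite_K: "finite K"
    and linear_xi: "k \<in> K \<Longrightarrow> linear (\<xi> k)"
    and ex_pos: "u \<noteq> 0 \<Longrightarrow> \<exists>k\<in>K. 0 < \<xi> k u"
    and irredundant: "j \<in> K \<Longrightarrow> \<exists>v. \<xi> j v = 1 \<and> (\<forall>k\<in>K - {j}. \<xi> k v < 1)"
begin

lemma K_nonempty: "K \<noteq> {}"
  using ex_pos nonempty_Basis nonzero_Basis by blast

lemma xi_add: "k \<in> K \<Longrightarrow> \<xi> k (u + v) = \<xi> k u + \<xi> k v"
  and xi_diff: "k \<in> K \<Longrightarrow> \<xi> k (u - v) = \<xi> k u - \<xi> k v"
  and xi_scale: "k \<in> K \<Longrightarrow> \<xi> k (c *\<^sub>R u) = c * \<xi> k u"
  and xi_zero: "k \<in> K \<Longrightarrow> \<xi> k 0 = 0"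
  and xi_minus: "k \<in> K \<Longrightarrow> \<xi> k (- u) = - \<xi> k u"
  by (simp_all add: linear_xi linear_add linear_diff linear_scale linear_0 linear_neg)

text \<open>\<open>K\<close> itself is not a dual face: if all functionals were 1 at
  \<open>v\<close>, all would be negative at \<open>- v\<close>. It is added as the index of
  \<open>V\<close>.\<close>

definition faces :: "'i set set"
  where "faces = dual_faces \<xi> K \<union> {K}"

text \<open>
  The full index set \<open>K\<close> is covered by the direction \<open>v = 0\<close> with \<open>s = 0\<close>, so that it needs no
  separate treatment.
\<close>

lemma mem_faces_iff:
  "L \<in> faces \<longleftrightarrow> L \<noteq> {} \<and> L \<subseteq> K \<and>
    (\<exists>v s. (\<forall>k\<in>L. \<xi> k v = s) \<and> (\<forall>k\<in>K - L. \<xi> k v < s))" (is "_ \<longleftrightarrow> ?r")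
proof
  assume "L \<in> faces"
  then consider "L = K" | "L \<in> dual_faces \<xi> K" unfolding faces_def by blast
  then show ?r
  proof cases
    case 1
    then show ?thesis using K_nonempty xi_zero by (auto intro!: exI[of _ 0])
  next
    case 2
    then obtain v where v: "L \<noteq> {}" "L \<subseteq> K" "max_fun \<xi> K v = 1" "L = {k \<in> K. \<xi> k v = 1}"
      unfolding dual_faces_def by blast
    have "\<forall>k\<in>K - L. \<xi> k v < 1"
      using le_max_fun[OF finite_K, of _ \<xi> v] v by (force simp: less_le)
    then show ?thesis using v by blast
  qed
next
  assume ?r
  then obtain v s where L: "L \<noteq> {}" "L \<subseteq> K" and vs: "\<forall>k\<in>L. \<xi> k v = s" "\<forall>k\<in>K - L. \<xi> k v < s"
    by blast
  show "L \<in> faces"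
  proof (cases "L = K")
    case False
    then obtain k where k: "k \<in> K - L" using L by blast
    \<comment> \<open>The index \<open>k\<close> takes a value strictly below \<open>s\<close>, so
      \<open>v\<close> is not zero. Boundedness of the ball then makes the maximum at
      \<open>v\<close>, which is \<open>s\<close>, positive, and dividing by \<open>s\<close> puts
      \<open>v\<close> on the unit sphere.\<close>
    have "v \<noteq> 0"
      using vs k L xi_zero by (metis DiffD1 all_not_in_conv order_less_irrefl subsetD)
    then obtain j where j: "j \<in> K" "0 < \<xi> j v" using ex_pos by blast
    then have s: "s > 0"
      by (cases "j \<in> L") (use vs in force)+
    define w where "w = v /\<^sub>R s"
    have w: "\<xi> i w = \<xi> i v / s" if "i \<in> K" for i
      using that by (simp add: w_def xi_scale field_simps)
    obtain l where l: "l \<in> L" using L by blast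
    have "max_fun \<xi> K w = 1"
    proof (rule max_fun_eqI[of K l])
      fix i assume "i \<in> K"
      then show "\<xi> i w \<le> 1" by (cases "i \<in> L") (use w vs s in force)+
    qed (use finite_K w l L vs s in auto)
    moreover have "L = {k \<in> K. \<xi> k w = 1}"
    proof -
      have "\<xi> i w = 1 \<longleftrightarrow> i \<in> L" if "i \<in> K" for i
        using that w[OF that] vs s by (cases "i \<in> L") force+
      then show ?thesis using L by blast
    qed
    ultimately show ?thesis using L unfolding faces_def dual_faces_def by blast
  qed (simp add: faces_def)
qed

lemma faces_subset: "L \<in> faces \<Longrightarrow> L \<subseteq> K"
  and faces_nonempty: "L \<in> faces \<Longrightarrow> L \<noteq> {}"
  by (simp_all add: mem_faces_iff)

lemma finite_face: "L \<in> faces \<Longrightarrow> finite L"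
  using faces_subset finite_K finite_subset by blast

section \<open>Horofunctions and the uniqueness of their parameters\<close>

lemma horofunction_pointed_continuous:
  assumes "L \<in> faces"
  shows "horofunction \<xi> L p \<in> pointed_continuous"
proof -
  have "continuous_on UNIV (max_fun \<xi> L)"
    using assms finite_face faces_nonempty faces_subset linear_xi
    by (intro continuous_on_max_fun linear_continuous_on linear_conv_bounded_linear[THEN iffD1]) blast+
  then have "continuous_on UNIV (\<lambda>u. max_fun \<xi> L (p - u))"
    by (rule continuous_on_compose2) (auto intro!: continuous_intros)
  then show ?thesis
    by (auto simp: pointed_continuous_def horofunction_def[abs_def] intro!: continuous_intros)
qed

text \<open>Adding \<open>a\<close> raises all functionals in \<open>L\<close> by one constant,
  which the normalization cancels.\<close>

lemma horofunction_add_equal_subspace: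
  assumes "L \<in> faces" "a \<in> equal_subspace \<xi> L"
  shows "horofunction \<xi> L (a + b) = horofunction \<xi> L b"
proof -
  obtain l where l: "l \<in> L" using faces_nonempty[OF assms(1)] by blast
  have a: "\<xi> k a = \<xi> l a" if "k \<in> L" for k
    using assms(2) that l unfolding equal_subspace_def by blast
  have "max_fun \<xi> L (a + c) = max_fun \<xi> L c + \<xi> l a" for c
    using assms(1) finite_face faces_nonempty faces_subset a
    by (intro max_fun_shift) (auto simp: xi_add subset_iff)
  from this[of "b - v" for v] this[of b] show ?thesis
    by (simp add: horofunction_def fun_eq_iff add_diff_eq)
qed

text \<open>The maximum is evaluated at \<open>p + t v\<close>, where \<open>\<xi> j\<close> has
  slope 1 and every other functional a smaller slope; hence \<open>j\<close> alone decides it for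
  large \<open>t\<close>.\<close>

lemma horofunction_direction:
  assumes "L \<in> faces" "j \<in> L" "\<xi> j v = 1" "\<forall>k\<in>K - {j}. \<xi> k v < 1"
  shows "\<forall>\<^sub>F t in at_top. horofunction \<xi> L p (- t *\<^sub>R v) = \<xi> j p - max_fun \<xi> L p + t"
proof -
  note fin = finite_face[OF assms(1)] and sub = faces_subset[OF assms(1)]
  have "\<forall>\<^sub>F t in at_top. \<forall>k\<in>L - {j}. \<xi> k p + t * \<xi> k v < \<xi> j p + t * 1"
    by (rule eventually_affine_less) (use fin sub assms in auto)
  then show ?thesis
  proof eventually_elim
    case (elim t)
    have "max_fun \<xi> L (p + t *\<^sub>R v) = \<xi> j p + t"
    proof (rule max_fun_eqI[OF fin assms(2)])
      show "\<xi> j (p + t *\<^sub>R v) = \<xi> j p + t"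
        using assms sub by (auto simp: xi_add xi_scale subset_iff)
      fix k assume "k \<in> L"
      then show "\<xi> k (p + t *\<^sub>R v) \<le> \<xi> j p + t"
        using elim assms sub
        by (cases "k = j") (auto simp: xi_add xi_scale subset_iff intro: less_imp_le)
    qed
    then show ?case by (simp add: horofunction_def)
  qed
qed

text \<open>Without \<open>j\<close>, all slopes are below 1. The constant \<open>c\<close> is free
  so that it can be set to the intercept found for a face containing \<open>j\<close>.\<close>

lemma horofunction_other_direction:
  assumes "L \<in> faces" "j \<notin> L" "\<forall>k\<in>K - {j}. \<xi> k v < 1"
  shows "\<forall>\<^sub>F t in at_top. horofunction \<xi> L p (- t *\<^sub>R v) < c + t"
proof -
  note fin = finite_face[OF assms(1)] and sub = faces_subset[OF assms(1)]
  have "\<forall>\<^sub>F t in at_top. \<forall>k\<in>L. \<xi> k p + t * \<xi> k v < (c + max_fun \<xi> L p) + t * 1"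
    by (rule eventually_affine_less) (use fin sub assms in auto)
  then show ?thesis
  proof eventually_elim
    case (elim t)
    have "max_fun \<xi> L (p + t *\<^sub>R v) < c + max_fun \<xi> L p + t"
      by (rule max_fun_lessI)
         (use fin faces_nonempty[OF assms(1)] elim sub in \<open>auto simp: xi_add xi_scale subset_iff\<close>)
    then show ?case by (simp add: horofunction_def)
  qed
qed

text \<open>
  Irredundancy recovers \<open>L\<close> and the numbers \<open>\<xi> j p - max_fun \<xi> L p\<close>, \<open>j \<in> L\<close>, from the growth of
  the horofunction along rays on which \<open>\<xi> j\<close> strictly dominates all other functionals.
\<close>

lemma horofunction_eq_imp_subset:
  assumes "L \<in> faces" "L' \<in> faces" "horofunction \<xi> L p = horofunction \<xi> L' q"
  shows "L \<subseteq> L'"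
proof
  fix j assume j: "j \<in> L"
  obtain v where v: "\<xi> j v = 1" "\<forall>k\<in>K - {j}. \<xi> k v < 1"
    using irredundant j faces_subset[OF assms(1)] by blast
  show "j \<in> L'"
  proof (rule ccontr)
    assume "j \<notin> L'"
    from horofunction_direction[OF assms(1) j v, of p]
      horofunction_other_direction[OF assms(2) this v(2), of q "\<xi> j p - max_fun \<xi> L p"]
    have "\<forall>\<^sub>F t :: real in at_top. False"
      by eventually_elim (simp add: assms(3))
    then show False by (simp add: trivial_limit_at_top_linorder)
  qed
qed

lemma horofunction_eq_imp_diff:
  assumes "L \<in> faces" "horofunction \<xi> L p = horofunction \<xi> L q"
  shows "p - q \<in> equal_subspace \<xi> L"
proof -
  \<comment> \<open>The right-hand side does not depend on \<open>j\<close>, which is what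
    membership in \<open>equal_subspace\<close> asks for.\<close>
  have *: "\<xi> j (p - q) = max_fun \<xi> L p - max_fun \<xi> L q" if j: "j \<in> L" for j
  proof -
    have jK: "j \<in> K" using j faces_subset[OF assms(1)] by blast
    obtain v where v: "\<xi> j v = 1" "\<forall>k\<in>K - {j}. \<xi> k v < 1"
      using irredundant jK by blast
    from horofunction_direction[OF assms(1) j v, of p]
      horofunction_direction[OF assms(1) j v, of q]
    have "\<forall>\<^sub>F t :: real in at_top. \<xi> j p - max_fun \<xi> L p = \<xi> j q - max_fun \<xi> L q"
      by eventually_elim (simp add: assms(2))
    then show ?thesis using jK by (simp add: trivial_limit_at_top_linorder xi_diff)
  qed
  then show ?thesis unfolding equal_subspace_def by simp
qed

lemma horofunction_eq_iff:
  assumes "L \<in> faces" "L' \<in> faces"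
  shows "horofunction \<xi> L p = horofunction \<xi> L' q \<longleftrightarrow> L = L' \<and> p - q \<in> equal_subspace \<xi> L"
proof
  assume eq: "horofunction \<xi> L p = horofunction \<xi> L' q"
  then have "L = L'"
    using horofunction_eq_imp_subset assms by (metis subset_antisym)
  then show "L = L' \<and> p - q \<in> equal_subspace \<xi> L"
    using horofunction_eq_imp_diff[OF assms(1)] eq by blast
next
  assume "L = L' \<and> p - q \<in> equal_subspace \<xi> L"
  then show "horofunction \<xi> L p = horofunction \<xi> L' q"
    using horofunction_add_equal_subspace[OF assms(1), of "p - q" q] by (metis diff_add_cancel)
qed

section \<open>The closure of the horofunctions of one face\<close>

lemma horofunction_in_closure:
  assumes "L \<in> faces" "L' \<in> faces" "L' \<subseteq> L"
  shows "horofunction \<xi> L' p \<in> ucb_topology closure_of range (horofunction \<xi> L)"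
proof -
  note fin = finite_face[OF assms(1)] and sub = faces_subset[OF assms(1)]
  note fin' = finite_face[OF assms(2)]
  obtain v s where vs: "\<forall>k\<in>L'. \<xi> k v = s" "\<forall>k\<in>K - L'. \<xi> k v < s"
    using assms(2) unfolding mem_faces_iff by blast
  obtain l where l: "l \<in> L'" using assms(2) faces_nonempty by blast
  have exact: "\<exists>q. \<forall>x\<in>S. horofunction \<xi> L q x = horofunction \<xi> L' p x" if S: "bounded S" for S
  proof -
    \<comment> \<open>The point 0 joins \<open>S\<close> because the normalizing term evaluates the
      maximum at \<open>q - 0\<close>.\<close>
    obtain C where C: "\<forall>k\<in>K. \<forall>x\<in>insert 0 S. \<bar>\<xi> k x\<bar> \<le> C"
    proof -
      have "\<forall>k\<in>K. bounded (\<xi> k ` insert 0 S)"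
        using S linear_xi
        by (intro ballI bounded_linear_image) (auto simp: linear_conv_bounded_linear)
      then have "bounded (\<Union>k\<in>K. \<xi> k ` insert 0 S)"
        using finite_K by (intro bounded_UN) auto
      then show thesis using that unfolding bounded_iff by fastforce
    qed
    \<comment> \<open>Adding \<open>C\<close> on one side and subtracting it on the other absorbs
      \<open>\<xi> k x\<close> and \<open>\<xi> l x\<close>, so one \<open>t\<close> works for all
      \<open>x\<close> in \<open>S\<close>.\<close>
    have "\<forall>\<^sub>F t in at_top. \<forall>k\<in>L - L'. (\<xi> k p + C) + t * \<xi> k v < (\<xi> l p - C) + t * s"
      by (rule eventually_affine_less) (use fin sub vs in auto)
    then obtain t where t: "\<forall>k\<in>L - L'. \<xi> k p + C + t * \<xi> k v < \<xi> l p - C + t * s"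
      using eventually_happens trivial_limit_at_top_linorder by blast
    define q where "q = p + t *\<^sub>R v"
    have "max_fun \<xi> L (q - x) = max_fun \<xi> L' (p - x) + t * s" if x: "x \<in> insert 0 S" for x
    proof -
      have "max_fun \<xi> L (q - x) = max_fun \<xi> L' (q - x)"
      proof (rule max_fun_restrict[OF fin assms(3) l])
        fix k assume k: "k \<in> L - L'"
        have "k \<in> K" "l \<in> K" using k l assms(3) sub by auto
        moreover have "\<bar>\<xi> k x\<bar> \<le> C" "\<bar>\<xi> l x\<bar> \<le> C" using C x calculation by auto
        moreover have "\<xi> k p + C + t * \<xi> k v < \<xi> l p - C + t * \<xi> l v"
          using t k vs(1) l by simp
        ultimately show "\<xi> k (q - x) \<le> \<xi> l (q - x)"
          unfolding q_def by (simp add: xi_diff xi_add xi_scale)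
      qed
      also have "\<dots> = max_fun \<xi> L' (p - x) + t * s"
        using fin' faces_nonempty[OF assms(2)] sub assms(3) vs(1)
        by (intro max_fun_shift) (auto simp: q_def xi_diff xi_add xi_scale subset_iff)
      finally show ?thesis .
    qed
    from this this[of 0] show ?thesis
      by (intro exI[of _ q]) (auto simp: horofunction_def)
  qed
  have "\<exists>g\<in>range (horofunction \<xi> L). \<forall>x\<in>S. \<bar>g x - horofunction \<xi> L' p x\<bar> < e"
    if "bounded S" "e > 0" for S e
  proof -
    obtain q where "\<forall>x\<in>S. horofunction \<xi> L q x = horofunction \<xi> L' p x"
      using exact \<open>bounded S\<close> by blast
    then show ?thesis using \<open>e > 0\<close> by (intro bexI[of _ "horofunction \<xi> L q"]) auto
  qed
  moreover have "range (horofunction \<xi> L) \<subseteq> pointed_continuous"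
    using horofunction_pointed_continuous[OF assms(1)] by blast
  ultimately show ?thesis
    using horofunction_pointed_continuous[OF assms(2)] by (simp add: in_closure_of_ucb_topology)
qed

lemma closure_imp_horofunction:
  assumes "L \<in> faces" and f: "f \<in> ucb_topology closure_of range (horofunction \<xi> L)"
  shows "\<exists>L'\<in>faces. \<exists>p. L' \<subseteq> L \<and> f = horofunction \<xi> L' p"
proof -
  note fin = finite_face[OF assms(1)] and sub = faces_subset[OF assms(1)]
  note ne = faces_nonempty[OF assms(1)]
  \<comment> \<open>Balls of growing radius with shrinking errors turn membership in the closure
    into a convergent sequence; only its pointwise limit is used afterwards.\<close>
  have "\<exists>p. \<forall>x\<in>ball 0 (real n). \<bar>horofunction \<xi> L p x - f x\<bar> < 1 / Suc n" for n
    using f horofunction_pointed_continuous[OF assms(1)]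
    by (subst (asm) in_closure_of_ucb_topology) auto
  then obtain p0 where p0: "\<And>n x. x \<in> ball 0 (real n) \<Longrightarrow> \<bar>horofunction \<xi> L (p0 n) x - f x\<bar> < 1 / Suc n"
    by metis
  have lim0: "(\<lambda>n. horofunction \<xi> L (p0 n) x) \<longlonglongrightarrow> f x" for x
  proof -
    have "\<forall>\<^sub>F n in sequentially. norm x < real n"
      by (metis eventually_at_top_dense filterlim_at_top_dense filterlim_real_sequentially)
    then have "\<forall>\<^sub>F n in sequentially. norm (horofunction \<xi> L (p0 n) x - f x) \<le> 1 / Suc n"
      by eventually_elim (use p0 in \<open>force intro: less_imp_le\<close>)
    then have "(\<lambda>n. horofunction \<xi> L (p0 n) x - f x) \<longlonglongrightarrow> 0"
      by (rule Lim_null_comparison[OF _ LIMSEQ_Suc[OF lim_1_over_n]])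
    then show ?thesis by (simp add: LIM_zero_iff)
  qed
  define c0 where "c0 l n = \<xi> l (p0 n) - max_fun \<xi> L (p0 n)" for l n
  have "\<forall>l\<in>L. \<forall>n. c0 l n \<le> 0"
    using le_max_fun[OF fin, of _ \<xi>] by (simp add: c0_def)
  from subsequence_bounded_or_at_bot[OF fin this]
  obtain r L' where r: "strict_mono (r :: nat \<Rightarrow> nat)" and L': "L' \<subseteq> L"
    and bdd0: "\<forall>l\<in>L'. \<exists>b. \<forall>n. b \<le> c0 l (r n)"
    and bot0: "\<forall>l\<in>L - L'. filterlim (\<lambda>n. c0 l (r n)) at_bot sequentially"
    by blast
  define p where "p = p0 \<circ> r"
  define c where "c l n = \<xi> l (p n) - max_fun \<xi> L (p n)" for l n
  have bdd: "\<exists>b. \<forall>n. b \<le> c l n" if "l \<in> L'" for l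
    using bdd0 that by (simp add: c_def c0_def p_def)
  have bot: "filterlim (c l) at_bot sequentially" if "l \<in> L - L'" for l
    using bot0 that by (simp add: c_def[abs_def] c0_def p_def)
  have c_le: "c l n \<le> 0" if "l \<in> L" for l n
    using le_max_fun[OF fin that, of \<xi>] by (simp add: c_def)
  have lim: "(\<lambda>n. horofunction \<xi> L (p n) x) \<longlonglongrightarrow> f x" for x
    using LIMSEQ_subseq_LIMSEQ[OF lim0 r] by (simp add: p_def o_def)
  \<comment> \<open>For each \<open>n\<close> some \<open>l\<close> attains the maximum, so
    \<open>c l n = 0\<close>; hence the finitely many \<open>c l\<close> cannot all tend to
    \<open>-\<infinity>\<close>.\<close>
  have "L' \<noteq> {}"
  proof
    assume "L' = {}"
    then have "\<forall>\<^sub>F n in sequentially. \<forall>l\<in>L. c l n < 0"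
      using bot fin by (intro eventually_ball_finite) (auto simp: filterlim_at_bot_dense)
    then obtain n where "\<forall>l\<in>L. c l n < 0"
      using eventually_happens sequentially_bot by blast
    moreover obtain l where "l \<in> L" "max_fun \<xi> L (p n) = \<xi> l (p n)"
      using max_fun_attained[OF fin ne, where \<xi> = \<xi> and u = "p n"] .
    ultimately show False by (auto simp: c_def)
  qed
  then obtain l where l: "l \<in> L'" by blast
  have L'K: "L' \<subseteq> K" and fin': "finite L'" using L' sub fin finite_subset by auto
  obtain B where B: "\<And>k n. k \<in> L' \<Longrightarrow> \<bar>c k n\<bar> \<le> B"
  proof -
    obtain b where b: "\<And>k n. k \<in> L' \<Longrightarrow> b k \<le> c k n" using bdd by metis
    show thesis
    proof
      fix k n assume k: "k \<in> L'"
      have "\<bar>c k n\<bar> \<le> \<bar>b k\<bar>" using b[OF k, of n] c_le[of k n] k L' by auto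
      also have "\<dots> \<le> (\<Sum>k\<in>L'. \<bar>b k\<bar>)" using fin' k by (intro member_le_sum) auto
      finally show "\<bar>c k n\<bar> \<le> (\<Sum>k\<in>L'. \<bar>b k\<bar>)" .
    qed
  qed
  define H where "H = equal_subspace \<xi> L'"
  have H: "subspace H"
    unfolding H_def using L'K linear_xi by (intro subspace_equal_subspace) auto
  have "\<exists>a b. a \<in> H \<and> b \<in> H\<^sup>\<bottom> \<and> p n = a + b" for n
    using subspace_sum_orthogonal_comp[OF H] set_plus_elim[of "p n" H "H\<^sup>\<bottom>"] by (metis UNIV_I)
  then obtain a b where a: "\<And>n. a n \<in> H" and b: "\<And>n. b n \<in> H\<^sup>\<bottom>" and p: "\<And>n. p n = a n + b n"
    by metis
  have aH: "\<xi> k (a n) = \<xi> l (a n)" if "k \<in> L'" for k n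
    using a[of n] l that unfolding H_def equal_subspace_def by blast
  obtain e where e: "e > 0" "\<And>x. x \<in> H\<^sup>\<bottom> \<Longrightarrow> e * norm x \<le> (\<Sum>k\<in>L'. \<bar>\<xi> k x - \<xi> l x\<bar>)"
    using orthogonal_equal_subspace_bound[OF fin' l, of \<xi>] linear_xi L'K unfolding H_def by blast
  have "norm (b n) \<le> (\<Sum>k\<in>L'. 2 * B) / e" for n
  proof -
    have "e * norm (b n) \<le> (\<Sum>k\<in>L'. \<bar>\<xi> k (b n) - \<xi> l (b n)\<bar>)" by (rule e(2)[OF b])
    also have "\<dots> \<le> (\<Sum>k\<in>L'. 2 * B)"
    proof (rule sum_mono)
      fix k assume k: "k \<in> L'"
      \<comment> \<open>Both the maximum in \<open>c\<close> and the component
        \<open>a n \<in> H\<close> cancel in the difference.\<close>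
      then have "\<xi> k (b n) - \<xi> l (b n) = c k n - c l n"
        using aH[OF k, of n] l L'K by (auto simp: c_def p xi_add subset_iff)
      then show "\<bar>\<xi> k (b n) - \<xi> l (b n)\<bar> \<le> 2 * B" using B[OF k, of n] B[OF l, of n] by linarith
    qed
    finally show ?thesis using e(1) by (simp add: field_simps)
  qed
  then have bb: "bounded (range b)" by (auto simp: bounded_iff)
  have far: "\<forall>\<^sub>F n in sequentially. \<forall>k\<in>L - L'. c k n < d" for d
    using bot fin by (intro eventually_ball_finite) (auto simp: filterlim_at_bot_dense)
  \<comment> \<open>The witness is \<open>a n\<close>, which separates \<open>L'\<close> from \<open>L - L'\<close>, plus a large multiple of a direction
    separating \<open>L\<close> from \<open>K - L\<close>.\<close>
  have face: "L' \<in> faces"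
  proof -
    obtain D where D: "\<And>k n. k \<in> K \<Longrightarrow> \<bar>\<xi> k (b n)\<bar> \<le> D"
    proof -
      have "\<forall>k\<in>K. bounded (\<xi> k ` range b)"
        using bb linear_xi
        by (intro ballI bounded_linear_image) (auto simp: linear_conv_bounded_linear)
      then have "bounded (\<Union>k\<in>K. \<xi> k ` range b)"
        using finite_K by (intro bounded_UN) auto
      then show thesis using that unfolding bounded_iff by fastforce
    qed
    \<comment> \<open>Since \<open>c l n \<ge> - B\<close>, this puts \<open>\<xi> l (p n)\<close>
      more than \<open>2 * D\<close> above \<open>\<xi> k (p n)\<close>; removing \<open>b n\<close>
      changes the gap by at most \<open>2 * D\<close>.\<close>
    obtain n where n: "\<forall>k\<in>L - L'. c k n < - B - 2 * D"
      using eventually_happens[OF far] sequentially_bot by blast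
    have less: "\<xi> k (a n) < \<xi> l (a n)" if k: "k \<in> L - L'" for k
    proof -
      have "k \<in> K" "l \<in> K" using k l L' sub by auto
      then show ?thesis
        using n k B[OF l, of n] D[of k n] D[of l n]
        by (force simp: c_def p xi_add)
    qed
    obtain v s where vs: "\<forall>k\<in>L. \<xi> k v = s" "\<forall>k\<in>K - L. \<xi> k v < s"
      using assms(1) unfolding mem_faces_iff by blast
    have "\<forall>\<^sub>F t in at_top. \<forall>k\<in>K - L. \<xi> k (a n) + t * \<xi> k v < \<xi> l (a n) + t * s"
      by (rule eventually_affine_less) (use finite_K vs in auto)
    then obtain t where t: "\<forall>k\<in>K - L. \<xi> k (a n) + t * \<xi> k v < \<xi> l (a n) + t * s"
      using eventually_happens trivial_limit_at_top_linorder by blast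
    show ?thesis
      unfolding mem_faces_iff
    proof (intro conjI exI ballI)
      show "L' \<noteq> {}" "L' \<subseteq> K" by fact+
      fix k assume k: "k \<in> L'"
      then show "\<xi> k (a n + t *\<^sub>R v) = \<xi> l (a n) + t * s"
        using aH[OF k, of n] vs(1) L' L'K by (auto simp: xi_add xi_scale subset_iff)
    next
      fix k assume k: "k \<in> K - L'"
      have "\<xi> k (a n) + t * \<xi> k v < \<xi> l (a n) + t * s"
      proof (cases "k \<in> L")
        case True
        then show ?thesis using less[of k] vs(1) k by simp
      next
        case False
        then show ?thesis using t k by blast
      qed
      then show "\<xi> k (a n + t *\<^sub>R v) < \<xi> l (a n) + t * s"
        using k by (simp add: xi_add xi_scale)
    qed
  qed
  obtain q y where q: "strict_mono (q :: nat \<Rightarrow> nat)" "(b \<circ> q) \<longlonglongrightarrow> y"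
    using bounded_imp_convergent_subsequence[OF bb] by blast
  have "f x = horofunction \<xi> L' y x" for x
  proof -
    obtain D where D: "\<And>k. k \<in> K \<Longrightarrow> \<bar>\<xi> k x\<bar> \<le> D"
    proof
      show "\<bar>\<xi> k x\<bar> \<le> (\<Sum>k\<in>K. \<bar>\<xi> k x\<bar>)" if "k \<in> K" for k
        using that finite_K by (intro member_le_sum) auto
    qed
    have "\<forall>\<^sub>F n in sequentially. horofunction \<xi> L (p n) x = horofunction \<xi> L' (b n) x"
      \<comment> \<open>The first threshold serves the point \<open>p n - x\<close>, where
        \<open>x\<close> shifts each functional by at most \<open>D\<close>; the second serves
        \<open>p n\<close> in the normalizing term.\<close>
      using far[of "- B - 2 * D"] far[of "-B"]
    proof eventually_elim
      case (elim n)
      have l': "l \<in> K" using l L'K by blast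
      have "max_fun \<xi> L (p n - x) = max_fun \<xi> L' (p n - x)"
      proof (rule max_fun_restrict[OF fin L' l])
        fix k assume k: "k \<in> L - L'"
        then have k': "k \<in> K" using sub by blast
        have "c k n < - B - 2 * D" using elim(1) k by blast
        then show "\<xi> k (p n - x) \<le> \<xi> l (p n - x)"
          using B[OF l, of n] D[OF k'] D[OF l'] unfolding c_def xi_diff[OF k'] xi_diff[OF l'] by linarith
      qed
      moreover have "max_fun \<xi> L (p n) = max_fun \<xi> L' (p n)"
      proof (rule max_fun_restrict[OF fin L' l])
        fix k assume k: "k \<in> L - L'"
        have "c k n < - B" using elim(2) k by blast
        then show "\<xi> k (p n) \<le> \<xi> l (p n)"
          using B[OF l, of n] unfolding c_def by linarith
      qed
      ultimately have "horofunction \<xi> L (p n) x = horofunction \<xi> L' (p n) x"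
        by (simp add: horofunction_def)
      then show ?case
        \<comment> \<open>Dropping \<open>a n \<in> H\<close> replaces \<open>p n\<close>, which may
          be unbounded, by \<open>b n\<close>, which has a convergent subsequence.\<close>
        unfolding p using horofunction_add_equal_subspace[OF face a[of n, unfolded H_def], of "b n"]
        by (simp only:)
    qed
    then have "(\<lambda>n. horofunction \<xi> L' (b n) x) \<longlonglongrightarrow> f x"
      by (rule Lim_transform_eventually[OF lim])
    then have 1: "(\<lambda>n. horofunction \<xi> L' (b (q n)) x) \<longlonglongrightarrow> f x"
      using LIMSEQ_subseq_LIMSEQ[OF _ q(1)] unfolding o_def by blast
    have "continuous_on UNIV (max_fun \<xi> L')"
      using fin' l L'K linear_xi
      by (intro continuous_on_max_fun linear_continuous_on linear_conv_bounded_linear[THEN iffD1]) blast+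
    then have cont: "isCont (max_fun \<xi> L') z" for z
      by (simp add: continuous_on_eq_continuous_at)
    have "(\<lambda>n. horofunction \<xi> L' (b (q n)) x) \<longlonglongrightarrow> horofunction \<xi> L' y x"
      unfolding horofunction_def using q(2)
      by (intro tendsto_diff isCont_tendsto_compose[OF cont] tendsto_const) (auto simp: o_def)
    with 1 show ?thesis by (rule LIMSEQ_unique)
  qed
  then show ?thesis using face L' by blast
qed

lemma closure_range_horofunction:
  assumes "L \<in> faces"
  shows "ucb_topology closure_of range (horofunction \<xi> L) =
    {horofunction \<xi> L' p | L' p. L' \<in> faces \<and> L' \<subseteq> L}"
  using closure_imp_horofunction[OF assms] horofunction_in_closure[OF assms] by blast

section \<open>Transport to the strata through \<open>Phi\<close>\<close>

lemma K_in_faces: "K \<in> faces"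
  by (simp add: faces_def)

lemma bordification_eq: "bordification \<xi> K = {horofunction \<xi> L p | L p. L \<in> faces}"
proof -
  have "range (\<lambda>p u. asym_dist \<xi> K p u - asym_dist \<xi> K p 0) = range (horofunction \<xi> K)"
    by (simp add: asym_dist_def horofunction_def[abs_def])
  then show ?thesis
    unfolding bordification_def using closure_range_horofunction[OF K_in_faces]
    by (simp add: faces_subset cong: conj_cong)
qed

text \<open>Applied to \<open>u\<close> and to \<open>- u\<close>, boundedness of the unit ball
  gives functionals of both signs at any nonzero \<open>u\<close>, so they cannot all agree
  there.\<close>

lemma equal_subspace_K: "equal_subspace \<xi> K = {0}"
proof -
  have "u = 0" if "u \<in> equal_subspace \<xi> K" for u
  proof (rule ccontr)
    assume "u \<noteq> 0"
    then obtain j k where "j \<in> K" "0 < \<xi> j u" "k \<in> K" "0 < \<xi> k (- u)"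
      using ex_pos[of u] ex_pos[of "- u"] by auto
    moreover then have "\<xi> j u = \<xi> k u" using that unfolding equal_subspace_def by blast
    ultimately show False by (simp add: xi_minus)
  qed
  then show ?thesis using xi_zero by (auto simp: equal_subspace_def)
qed

lemma mem_coset_iff: "x \<in> (+) p ` equal_subspace \<xi> L \<longleftrightarrow> x - p \<in> equal_subspace \<xi> L"
  by (auto intro: image_eqI[of _ _ "x - p"])

lemma coset_eq_iff:
  assumes "L \<in> faces"
  shows "(+) p ` equal_subspace \<xi> L = (+) q ` equal_subspace \<xi> L \<longleftrightarrow> p - q \<in> equal_subspace \<xi> L"
proof -
  have H: "subspace (equal_subspace \<xi> L)"
    using assms faces_subset linear_xi by (intro subspace_equal_subspace) blast
  show ?thesis
  proof
    assume "(+) p ` equal_subspace \<xi> L = (+) q ` equal_subspace \<xi> L"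
    then show "p - q \<in> equal_subspace \<xi> L" using mem_coset_iff subspace_0[OF H] by (metis diff_self)
  next
    assume pq: "p - q \<in> equal_subspace \<xi> L"
    have "x - p \<in> equal_subspace \<xi> L \<longleftrightarrow> x - q \<in> equal_subspace \<xi> L" for x
      using subspace_add[OF H pq, of "x - p"] subspace_diff[OF H _ pq, of "x - q"] by auto
    then show "(+) p ` equal_subspace \<xi> L = (+) q ` equal_subspace \<xi> L"
      by (simp add: set_eq_iff mem_coset_iff)
  qed
qed

text \<open>The singletons encoding \<open>V\<close> are the cosets of the zero subspace
  \<open>equal_subspace \<xi> K\<close>, which gives all strata one form.\<close>

lemma stratum_eq:
  assumes "L \<in> faces"
  shows "stratum \<xi> K L = range (\<lambda>p. (+) p ` equal_subspace \<xi> L)"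
proof (cases "L = K")
  case True
  then show ?thesis by (simp add: stratum_def equal_subspace_K)
next
  case False
  have H: "subspace (equal_subspace \<xi> L)"
    using assms faces_subset linear_xi by (intro subspace_equal_subspace) blast
  have "{(u, v). u - v \<in> equal_subspace \<xi> L} `` {p} = (+) p ` equal_subspace \<xi> L" for p
  proof -
    have "p - x \<in> equal_subspace \<xi> L \<longleftrightarrow> x - p \<in> equal_subspace \<xi> L" for x
      using subspace_neg[OF H] by (metis minus_diff_eq)
    then show ?thesis by (simp add: set_eq_iff mem_coset_iff)
  qed
  then show ?thesis using False by (simp add: stratum_def quotient_def UNION_singleton_eq_range)
qed

text \<open>The description operator is well defined because a horofunction determines its face and
  its coset.\<close>

lemma Phi_horofunction:
  assumes "L \<in> faces"
  shows "Phi \<xi> K (horofunction \<xi> L p) = (L, (+) p ` equal_subspace \<xi> L)"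
proof -
  have *: "(\<exists>q. f = horofunction \<xi> K q \<and> x = (K, {q})) \<or>
    (\<exists>L\<in>dual_faces \<xi> K. \<exists>q. f = horofunction \<xi> L q \<and> x = (L, (+) q ` equal_subspace \<xi> L)) \<longleftrightarrow>
    (\<exists>L\<in>faces. \<exists>q. f = horofunction \<xi> L q \<and> x = (L, (+) q ` equal_subspace \<xi> L))" for f x
    by (auto simp: faces_def equal_subspace_K)
  show ?thesis
    unfolding Phi_def *
  proof (rule the_equality)
    fix x assume "\<exists>L'\<in>faces. \<exists>q. horofunction \<xi> L p = horofunction \<xi> L' q \<and>
      x = (L', (+) q ` equal_subspace \<xi> L')"
    then obtain L' q where "L' \<in> faces" "horofunction \<xi> L p = horofunction \<xi> L' q"
      "x = (L', (+) q ` equal_subspace \<xi> L')" by blast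
    then show "x = (L, (+) p ` equal_subspace \<xi> L)"
      using assms by (metis horofunction_eq_iff coset_eq_iff)
  qed (use assms in blast)
qed

lemma inv_into_Phi:
  assumes "L \<in> faces"
  shows "inv_into (bordification \<xi> K) (Phi \<xi> K) (L, (+) p ` equal_subspace \<xi> L) = horofunction \<xi> L p"
proof -
  have "inj_on (Phi \<xi> K) (bordification \<xi> K)"
    unfolding bordification_eq
    by (rule inj_onI) (auto simp: Phi_horofunction horofunction_eq_iff coset_eq_iff)
  then show ?thesis
    using assms
    by (metis (mono_tags, lifting) Phi_horofunction bordification_eq inv_into_f_f mem_Collect_eq)
qed

text \<open>The inverse of \<open>Phi\<close> carries the stratum onto
  \<open>range (horofunction \<xi> L)\<close>, whose closure is known; the pullback carries that
  closure back.\<close>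

lemma closure_of_stratum:
  assumes L: "L \<in> faces"
  shows "strata_topology \<xi> K closure_of ({L} \<times> stratum \<xi> K L) =
    (SIGMA L' : {L' \<in> faces. L' \<subseteq> L}. stratum \<xi> K L')"
proof -
  let ?g = "inv_into (bordification \<xi> K) (Phi \<xi> K)"
  have strata: "strata \<xi> K = (SIGMA L : faces. stratum \<xi> K L)"
    by (simp add: strata_def faces_def)
  have g: "?g ` strata \<xi> K \<subseteq> bordification \<xi> K"
  proof
    fix f assume "f \<in> ?g ` strata \<xi> K"
    then obtain L' p where "L' \<in> faces" "f = ?g (L', (+) p ` equal_subspace \<xi> L')"
      unfolding strata by (auto simp: stratum_eq)
    then show "f \<in> bordification \<xi> K"
      unfolding bordification_eq[symmetric] by (auto simp: inv_into_Phi) (auto simp: bordification_eq)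
  qed
  have "bordification \<xi> K \<subseteq> pointed_continuous"
    using horofunction_pointed_continuous by (auto simp: bordification_eq)
  then have top: "topspace (subtopology ucb_topology (bordification \<xi> K)) = bordification \<xi> K"
    by (simp add: topspace_ucb_topology Int_absorb1)
  have im: "?g ` ({L} \<times> stratum \<xi> K L) = range (horofunction \<xi> L)"
    using inv_into_Phi[OF L] by (auto simp: stratum_eq[OF L] image_iff)
  have sub: "range (horofunction \<xi> L) \<subseteq> bordification \<xi> K"
    using L by (auto simp: bordification_eq)
  have "strata_topology \<xi> K closure_of ({L} \<times> stratum \<xi> K L) =
    {x \<in> strata \<xi> K. ?g x \<in> bordification \<xi> K \<inter> ucb_topology closure_of range (horofunction \<xi> L)}"
    unfolding strata_topology_def
  proof (subst closure_of_pullback_topology)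
    show "?g ` strata \<xi> K \<subseteq> topspace (subtopology ucb_topology (bordification \<xi> K))"
      unfolding top by (rule g)
    show "{L} \<times> stratum \<xi> K L \<subseteq> strata \<xi> K" using L by (auto simp: strata)
  qed (simp add: im closure_of_subtopology Int_absorb1[OF sub])
  also have "\<dots> = {x \<in> strata \<xi> K. ?g x \<in> {horofunction \<xi> L' p | L' p. L' \<in> faces \<and> L' \<subseteq> L}}"
    unfolding closure_range_horofunction[OF L] using g by blast
  also have "\<dots> = (SIGMA L' : {L' \<in> faces. L' \<subseteq> L}. stratum \<xi> K L')"
  proof -
    \<comment> \<open>A horofunction determines its index, so one with index \<open>L'\<close>
      belongs to this family only through \<open>L'\<close> itself.\<close>
    have "?g (L', X) \<in> {horofunction \<xi> L' p | L' p. L' \<in> faces \<and> L' \<subseteq> L} \<longleftrightarrow> L' \<subseteq> L"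
      if L': "L' \<in> faces" and X: "X \<in> stratum \<xi> K L'" for L' X
    proof -
      obtain p where "X = (+) p ` equal_subspace \<xi> L'" using X by (auto simp: stratum_eq[OF L'])
      then have "?g (L', X) = horofunction \<xi> L' p" by (simp add: inv_into_Phi[OF L'])
      then show ?thesis using L' by (auto simp: horofunction_eq_iff)
    qed
    then show ?thesis unfolding strata by auto
  qed
  finally show ?thesis .
qed

end

section \<open>From the facets of the polyhedron to the functionals\<close>

lemma polyhedral_norm_of_facets:
  fixes B :: "'a::euclidean_space set" and \<xi> :: "'i \<Rightarrow> 'a \<Rightarrow> real"
  assumes "compact B" "convex B" "polyhedron B" "0 \<in> interior B" "finite K"
    and bij: "bij_betw A K {F. F facet_of B}"
    and A: "\<And>j. j \<in> K \<Longrightarrow> linear (\<xi> j) \<and> A j = {v \<in> B. \<xi> j v = 1}"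
  shows "polyhedral_norm \<xi> K"
proof (rule polyhedral_norm.intro)
  have facet: "A j facet_of B" if "j \<in> K" for j
    using bij that by (auto simp: bij_betw_def)
  have lin: "linear (\<xi> j)" if "j \<in> K" for j using A that by blast
  \<comment> \<open>Otherwise the segment from \<open>0\<close> to \<open>x\<close> meets \<open>A j\<close> in an interior point of \<open>B\<close>.\<close>
  have le: "\<xi> j x \<le> 1" if "j \<in> K" "x \<in> B" for j x
  proof (rule ccontr)
    assume "\<not> \<xi> j x \<le> 1"
    then have gt: "\<xi> j x > 1" by simp
    \<comment> \<open>The factor \<open>1 - e\<close> scales the value \<open>\<xi> j x\<close> down
      to exactly 1.\<close>
    define e where "e = 1 - 1 / \<xi> j x"
    have e: "0 < e" "e \<le> 1" using gt by (auto simp: e_def)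
    have int: "x - e *\<^sub>R (x - 0) \<in> interior B"
      by (rule mem_interior_convex_shrink) (use assms that e in auto)
    have "\<xi> j (x - e *\<^sub>R (x - 0)) = 1"
      using gt lin[OF that(1)] by (simp add: linear_diff linear_scale e_def field_simps)
    then have "x - e *\<^sub>R (x - 0) \<in> A j"
      using A[OF that(1)] int interior_subset by blast
    moreover have "A j \<inter> interior B = {}"
      using facet[OF that(1)] by (intro face_of_disjoint_interior) (auto simp: facet_of_def)
    ultimately show False using int by blast
  qed
  show "\<exists>k\<in>K. 0 < \<xi> k u" if u: "u \<noteq> 0" for u
  proof -
    \<comment> \<open>The ray through \<open>u\<close> leaves the bounded set \<open>B\<close> at
      \<open>d u\<close>. The frontier of a polyhedron with interior is the union of its facets, so
      some functional is 1 there.\<close>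
    obtain d where d: "0 < d" "0 + d *\<^sub>R u \<in> frontier B"
      by (rule ray_to_frontier[OF compact_imp_bounded[OF assms(1)] assms(4) u]) blast
    have "frontier B = B - rel_interior B"
      using assms(1,4) rel_interior_nonempty_interior[of B]
      by (auto simp: frontier_def closure_closed compact_imp_closed)
    then have "d *\<^sub>R u \<in> \<Union> (A ` K)"
      using d rel_boundary_of_polyhedron[OF \<open>polyhedron B\<close>] bij_betw_imp_surj_on[OF bij] by simp
    then obtain k where "k \<in> K" "d *\<^sub>R u \<in> A k" by blast
    then have "d * \<xi> k u = 1" using A[of k] by (auto simp: linear_scale)
    then show ?thesis using \<open>k \<in> K\<close> d(1) by (metis zero_less_mult_pos zero_less_one)
  qed
  show "\<exists>v. \<xi> j v = 1 \<and> (\<forall>k\<in>K - {j}. \<xi> k v < 1)" if j: "j \<in> K" for j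
  proof -
    have F: "A i face_of B" "A i \<noteq> {}" "convex (A i)" "aff_dim (A i) = aff_dim B - 1"
      if "i \<in> K" for i
      using facet[OF that] by (auto simp: facet_of_def face_of_imp_convex)
    \<comment> \<open>If a second functional were 1 at a relative interior point of
      \<open>A j\<close>, the face \<open>A k\<close> would contain \<open>A j\<close>; equal
      dimensions would make them equal, against the injectivity of \<open>A\<close>.\<close>
    obtain v where v: "v \<in> rel_interior (A j)" using F[OF j] rel_interior_eq_empty by blast
    then have vA: "v \<in> A j" using rel_interior_subset by blast
    have "\<xi> k v < 1" if k: "k \<in> K - {j}" for k
    proof (rule ccontr)
      assume "\<not> \<xi> k v < 1"
      then have "\<xi> k v = 1" using le[of k v] k vA A[OF j] by auto
      then have "v \<in> A k" using A[of k] k vA A[OF j] by auto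
      then have sub: "A j \<subseteq> A k"
        using subset_of_face_of[of "A k" B "A j"] F k j v face_of_imp_subset by blast
      then have "A j face_of A k"
        using F k j face_of_subset face_of_imp_subset by (metis DiffD1)
      then have "A j = A k"
        using face_of_aff_dim_lt[of "A k" "A j"] F j k by force
      then show False using bij j k by (auto simp: bij_betw_def inj_on_def)
    qed
    then show ?thesis using vA A[OF j] by blast
  qed
qed (simp_all add: assms(5) A)

theorem corollary6p27:
  fixes B :: "'a::euclidean_space set"
    and m :: nat
    and A :: "nat \<Rightarrow> 'a set"
    and \<xi> :: "nat \<Rightarrow> 'a \<Rightarrow> real"
    and K :: "nat set"
  assumes "compact B" and "convex B" and "polyhedron B" and "0 \<in> interior B"
    and "K = {0..m}"
    and "bij_betw A K {F. F facet_of B}"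
    and "\<And>j. j \<in> K \<Longrightarrow> linear (\<xi> j) \<and> A j = {v \<in> B. \<xi> j v = 1}"
  shows "\<forall>L \<in> dual_faces \<xi> K \<union> {K}.
    strata_topology \<xi> K closure_of ({L} \<times> stratum \<xi> K L) =
      (SIGMA L' : {L' \<in> dual_faces \<xi> K \<union> {K}. L \<supseteq> L'}. stratum \<xi> K L')"
proof -
  interpret polyhedral_norm \<xi> K
    by (rule polyhedral_norm_of_facets[of B K A]) (use assms in auto)
  show ?thesis
    using closure_of_stratum unfolding faces_def by blast
qed

end
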